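(* Let $(X,d)$ be a metric space with at least two points and let $\mathcal{B}$ be a bornology on $X$ with a closed base. Then the following statements hold: (i) $w(C(X),\tau_{\mathcal{B}}^{sw}) = w(C(X),\tau_{\mathcal{B}}^s)$; and $w(C(X),\tau_{\mathcal{B}}^{w}) = w(C(X),\tau_{\mathcal{B}})$. (ii) $nw(C(X),\tau_{\mathcal{B}}^{sw}) = nw(C(X),\tau_{\mathcal{B}}^s)$; and $nw(C(X),\tau_{\mathcal{B}}^{w}) = nw(C(X),\tau_{\mathcal{B}})$. (iii) $ib(C(X),\tau_{\mathcal{B}}^{sw}) = ib(C(X),\tau_{\mathcal{B}}^s)$; and $ib(C(X),\tau_{\mathcal{B}}^{w}) = ib(C(X),\tau_{\mathcal{B}})$.
   Context: A bornology on $X$ is a family $\mathcal{B}$ of nonempty subsets of $X$ that covers $X$ and is an ideal, i.e. is closed under finite unions and under passing to nonempty subsets. A base for $\mathcal{B}$ is a subfamily $\mathcal{B}_0\subseteq\mathcal{B}$ such that every $B\in\mathcal{B}$ is contained in some $B'\in\mathcal{B}_0$; $\mathcal{B}$ has a closed base if it has a base all of whose members are closed in $(X,d)$. $C(X)$ is the set of continuous functions $X\to\mathbb{R}$, and $C^+(X)$ the set of continuous functions $X\to(0,\infty)$. For $A\subseteq X$ nonempty and $\delta>0$, $A^\delta=\bigcup_{x\in A}\{y\in X: d(x,y)<\delta\}$. Four topologies on $C(X)$ are induced by the uniformities with the following bases of entourages, $B$ ranging over $\mathcal{B}$: $\tau_{\mathcal{B}}$: $\{(f,g): |f(x)-g(x)|<\epsilon\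 \forall x\in B\}$, $\epsilon>0$ real; $\tau_{\mathcal{B}}^{s}$: $\{(f,g): \exists\,\delta>0\ \forall x\in B^\delta,\ |f(x)-g(x)|<\epsilon\}$, $\epsilon>0$ real; $\tau_{\mathcal{B}}^{w}$: $\{(f,g): |f(x)-g(x)|<\epsilon(x)\ \forall x\in B\}$, $\epsilon\in C^+(X)$; $\tau_{\mathcal{B}}^{sw}$: $\{(f,g): \exists\,\delta>0\ \forall x\in B^\delta,\ |f(x)-g(x)|<\epsilon(x)\}$, $\epsilon\in C^+(X)$. With each of these topologies $C(X)$ is a topological group under pointwise addition. For a topological space $Y$: weight $w(Y)=\aleph_0+\min\{|\mathscr{B}|:\mathscr{B}\text{ is a base for }Y\}$; a network on $Y$ is a collection $\mathscr{N}$ of nonempty subsets such that for each $y\in Y$ and open $U\ni y$ there is $C\in\mathscr{N}$ with $y\in C\subseteq U$; network weight $nw(Y)=\aleph_0+\min\{|\mathscr{N}|:\mathscr{N}\text{ is a network on }Y\}$. For an additive topological group $Y$ and an infinite cardinal $\lambda$, $Y$ is $\lambda$-narrow if for every neighborhood $U$ of the identity there is $S\subseteq Y$ with $|S|\le\lambda$ and $Y=U+S$; the index of narrowness is $ib(Y)=\aleph_0+\min\{\lambda: Y\text{ is }\lambda\text{-narrow}\}$. *)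

theory Defs
  imports "HOL-Analysis.Analysis" "HOL-Library.Function_Algebras"
begin

unbundle cardinal_syntax

section \<open>Bornologies\<close>

definition bornology :: "'a set set \<Rightarrow> bool" where
  "bornology \<B> \<longleftrightarrow>
     {} \<notin> \<B> \<and> \<Union>\<B> = UNIV \<and>
     (\<forall>A\<in>\<B>. \<forall>B\<in>\<B>. A \<union> B \<in> \<B>) \<and>
     (\<forall>B\<in>\<B>. \<forall>A. A \<subseteq> B \<and> A \<noteq> {} \<longrightarrow> A \<in> \<B>)"

definition bornology_base :: "'a set set \<Rightarrow> 'a set set \<Rightarrow> bool" where
  "bornology_base \<B> \<B>\<^sub>0 \<longleftrightarrow> \<B>\<^sub>0 \<subseteq> \<B> \<and> (\<forall>B\<in>\<B>. \<exists>B'\<in>\<B>\<^sub>0. B \<subseteq> B')"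

definition has_closed_base :: "'a::topological_space set set \<Rightarrow> bool" where
  "has_closed_base \<B> \<longleftrightarrow> (\<exists>\<B>\<^sub>0. bornology_base \<B> \<B>\<^sub>0 \<and> (\<forall>B\<in>\<B>\<^sub>0. closed B))"


section \<open>Topologies induced by a base of entourages\<close>

definition uniformity_base :: "'y set \<Rightarrow> ('y \<times> 'y) set set \<Rightarrow> bool" where
  "uniformity_base S \<E> \<longleftrightarrow>
     \<E> \<noteq> {} \<and>
     (\<forall>E\<in>\<E>. E \<subseteq> S \<times> S \<and> Id_on S \<subseteq> E) \<and>
     (\<forall>E\<in>\<E>. \<exists>D\<in>\<E>. D \<subseteq> E\<inverse>) \<and>
     (\<forall>E\<in>\<E>. \<exists>D\<in>\<E>. D O D \<subseteq> E) \<and>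
     (\<forall>E\<in>\<E>. \<forall>E'\<in>\<E>. \<exists>D\<in>\<E>. D \<subseteq> E \<inter> E')"

definition entourage_topology :: "'y set \<Rightarrow> ('y \<times> 'y) set set \<Rightarrow> 'y topology" where
  "entourage_topology S \<E> =
     topology (\<lambda>U. U \<subseteq> S \<and> (\<forall>f\<in>U. \<exists>E\<in>\<E>. E `` {f} \<subseteq> U))"

lemma openin_entourage_topology:
  assumes "uniformity_base S \<E>"
  shows "openin (entourage_topology S \<E>) U \<longleftrightarrow>
           U \<subseteq> S \<and> (\<forall>f\<in>U. \<exists>E\<in>\<E>. E `` {f} \<subseteq> U)"
proof -
  have "istopology (\<lambda>U. U \<subseteq> S \<and> (\<forall>f\<in>U. \<exists>E\<in>\<E>. E `` {f} \<subseteq> U))"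
    unfolding istopology_def
  proof (intro conjI allI impI ballI)
    fix U V f
    assume U: "U \<subseteq> S \<and> (\<forall>f\<in>U. \<exists>E\<in>\<E>. E `` {f} \<subseteq> U)"
      and V: "V \<subseteq> S \<and> (\<forall>f\<in>V. \<exists>E\<in>\<E>. E `` {f} \<subseteq> V)"
    then show "U \<inter> V \<subseteq> S" by blast
    assume "f \<in> U \<inter> V"
    with U V obtain E E' where E: "E \<in> \<E>" "E' \<in> \<E>" "E `` {f} \<subseteq> U" "E' `` {f} \<subseteq> V"
      by blast
    moreover obtain D where "D \<in> \<E>" "D \<subseteq> E \<inter> E'"
      using assms E(1,2) by (meson uniformity_base_def)
    ultimately show "\<exists>E\<in>\<E>. E `` {f} \<subseteq> U \<inter> V" by blast
  next
    fix \<K> f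
    assume K: "\<forall>K\<in>\<K>. K \<subseteq> S \<and> (\<forall>f\<in>K. \<exists>E\<in>\<E>. E `` {f} \<subseteq> K)"
    then show "\<Union>\<K> \<subseteq> S" by blast
    assume "f \<in> \<Union>\<K>"
    then obtain K where "K \<in> \<K>" "f \<in> K" by blast
    moreover from this K obtain E where "E \<in> \<E>" "E `` {f} \<subseteq> K" by blast
    ultimately show "\<exists>E\<in>\<E>. E `` {f} \<subseteq> \<Union>\<K>" by blast
  qed
  then show ?thesis
    by (simp add: entourage_topology_def)
qed

lemma topspace_entourage_topology:
  assumes "uniformity_base S \<E>"
  shows "topspace (entourage_topology S \<E>) = S"
proof -
  have "openin (entourage_topology S \<E>) S"
  proof -
    obtain E where E: "E \<in> \<E>" "E \<subseteq> S \<times> S"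
      using assms by (auto simp: uniformity_base_def)
    then have "E `` {f} \<subseteq> S" for f by blast
    with E(1) show ?thesis
      unfolding openin_entourage_topology[OF assms] by blast
  qed
  moreover have "topspace (entourage_topology S \<E>) \<subseteq> S"
    using openin_topspace[of "entourage_topology S \<E>"]
    unfolding openin_entourage_topology[OF assms] by blast
  ultimately show ?thesis
    by (simp add: openin_subset subset_antisym)
qed


section \<open>The four topologies on the space of continuous functions\<close>

definition cont_fun :: "('a::metric_space \<Rightarrow> real) set" where
  "cont_fun = {f. continuous_on UNIV f}"

definition pos_cont_fun :: "('a::metric_space \<Rightarrow> real) set" where
  "pos_cont_fun = {f. continuous_on UNIV f \<and> (\<forall>x. 0 < f x)}"

definition enlargement :: "'a::metric_space set \<Rightarrow> real \<Rightarrow> 'a set" where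
  "enlargement A \<delta> = (\<Union>x\<in>A. {y. dist x y < \<delta>})"

definition ent :: "'a::metric_space set \<Rightarrow> real \<Rightarrow> (('a \<Rightarrow> real) \<times> ('a \<Rightarrow> real)) set" where
  "ent B \<epsilon> = {(f, g) \<in> cont_fun \<times> cont_fun. \<forall>x\<in>B. \<bar>f x - g x\<bar> < \<epsilon>}"

definition ent_s :: "'a::metric_space set \<Rightarrow> real \<Rightarrow> (('a \<Rightarrow> real) \<times> ('a \<Rightarrow> real)) set" where
  "ent_s B \<epsilon> =
     {(f, g) \<in> cont_fun \<times> cont_fun. \<exists>\<delta>>0. \<forall>x\<in>enlargement B \<delta>. \<bar>f x - g x\<bar> < \<epsilon>}"

definition ent_w ::
  "'a::metric_space set \<Rightarrow> ('a \<Rightarrow> real) \<Rightarrow> (('a \<Rightarrow> real) \<times> ('a \<Rightarrow> real)) set" where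
  "ent_w B \<epsilon> = {(f, g) \<in> cont_fun \<times> cont_fun. \<forall>x\<in>B. \<bar>f x - g x\<bar> < \<epsilon> x}"

definition ent_sw ::
  "'a::metric_space set \<Rightarrow> ('a \<Rightarrow> real) \<Rightarrow> (('a \<Rightarrow> real) \<times> ('a \<Rightarrow> real)) set" where
  "ent_sw B \<epsilon> =
     {(f, g) \<in> cont_fun \<times> cont_fun. \<exists>\<delta>>0. \<forall>x\<in>enlargement B \<delta>. \<bar>f x - g x\<bar> < \<epsilon> x}"

definition tau :: "'a::metric_space set set \<Rightarrow> ('a \<Rightarrow> real) topology" where
  "tau \<B> = entourage_topology cont_fun {ent B \<epsilon> | B \<epsilon>. B \<in> \<B> \<and> 0 < \<epsilon>}"

definition tau_s :: "'a::metric_space set set \<Rightarrow> ('a \<Rightarrow> real) topology" where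
  "tau_s \<B> = entourage_topology cont_fun {ent_s B \<epsilon> | B \<epsilon>. B \<in> \<B> \<and> 0 < \<epsilon>}"

definition tau_w :: "'a::metric_space set set \<Rightarrow> ('a \<Rightarrow> real) topology" where
  "tau_w \<B> = entourage_topology cont_fun {ent_w B \<epsilon> | B \<epsilon>. B \<in> \<B> \<and> \<epsilon> \<in> pos_cont_fun}"

definition tau_sw :: "'a::metric_space set set \<Rightarrow> ('a \<Rightarrow> real) topology" where
  "tau_sw \<B> = entourage_topology cont_fun {ent_sw B \<epsilon> | B \<epsilon>. B \<in> \<B> \<and> \<epsilon> \<in> pos_cont_fun}"

lemma enlargement_mono: "A \<subseteq> B \<Longrightarrow> \<delta> \<le> \<gamma> \<Longrightarrow> enlargement A \<delta> \<subseteq> enlargement B \<gamma>"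
  unfolding enlargement_def by (auto intro: less_le_trans)


text \<open>The constant functions in the role of \<open>P\<close> give the uniformities with real \<open>\<epsilon>\<close>.\<close>

lemma uniformity_base_ent_w:
  assumes "bornology \<B>" and P: "P \<subseteq> pos_cont_fun" "P \<noteq> {}"
    "\<And>\<epsilon>. \<epsilon> \<in> P \<Longrightarrow> (\<lambda>x. \<epsilon> x / 2) \<in> P"
    "\<And>\<epsilon> \<epsilon>'. \<epsilon> \<in> P \<Longrightarrow> \<epsilon>' \<in> P \<Longrightarrow> (\<lambda>x. min (\<epsilon> x) (\<epsilon>' x)) \<in> P"
  shows "uniformity_base cont_fun {ent_w B \<epsilon> | B \<epsilon>. B \<in> \<B> \<and> \<epsilon> \<in> P}" (is "uniformity_base _ ?\<E>")
proof -
  have ne: "\<B> \<noteq> {}"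
    using assms(1) by (auto simp: bornology_def)
  have un: "\<And>A B. A \<in> \<B> \<Longrightarrow> B \<in> \<B> \<Longrightarrow> A \<union> B \<in> \<B>"
    using assms(1) by (simp add: bornology_def)
  have pos: "\<And>\<epsilon> x. \<epsilon> \<in> P \<Longrightarrow> 0 < \<epsilon> x"
    using P(1) by (auto simp: pos_cont_fun_def)
  show ?thesis
    unfolding uniformity_base_def
  proof (intro conjI ballI)
    show "?\<E> \<noteq> {}" using ne P(2) by blast
  next
    fix E assume "E \<in> ?\<E>"
    then obtain B \<epsilon> where E: "E = ent_w B \<epsilon>" "B \<in> \<B>" "\<epsilon> \<in> P" by blast
    show "E \<subseteq> cont_fun \<times> cont_fun" "Id_on cont_fun \<subseteq> E"
      using pos[OF E(3)] by (auto simp: E(1) ent_w_def)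
    have "E \<subseteq> E\<inverse>"
      by (auto simp: E(1) ent_w_def abs_minus_commute)
    then show "\<exists>D\<in>?\<E>. D \<subseteq> E\<inverse>" using \<open>E \<in> ?\<E>\<close> by blast
    have "ent_w B (\<lambda>x. \<epsilon> x / 2) O ent_w B (\<lambda>x. \<epsilon> x / 2) \<subseteq> E"
    proof (clarify)
      fix f g h
      assume fg: "(f, g) \<in> ent_w B (\<lambda>x. \<epsilon> x / 2)" and gh: "(g, h) \<in> ent_w B (\<lambda>x. \<epsilon> x / 2)"
      have "\<bar>f x - h x\<bar> < \<epsilon> x" if "x \<in> B" for x
      proof -
        have "\<bar>f x - g x\<bar> < \<epsilon> x / 2" "\<bar>g x - h x\<bar> < \<epsilon> x / 2"
          using fg gh that by (simp_all add: ent_w_def)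
        then show ?thesis by linarith
      qed
      then show "(f, h) \<in> E"
        using fg gh by (simp add: E(1) ent_w_def)
    qed
    then show "\<exists>D\<in>?\<E>. D O D \<subseteq> E" using E(2) P(3)[OF E(3)] by blast
    fix E' assume "E' \<in> ?\<E>"
    then obtain B' \<epsilon>' where E': "E' = ent_w B' \<epsilon>'" "B' \<in> \<B>" "\<epsilon>' \<in> P" by blast
    have "ent_w (B \<union> B') (\<lambda>x. min (\<epsilon> x) (\<epsilon>' x)) \<subseteq> E \<inter> E'"
      by (auto simp: E(1) E'(1) ent_w_def)
    then show "\<exists>D\<in>?\<E>. D \<subseteq> E \<inter> E'"
      using un[OF E(2) E'(2)] P(4)[OF E(3) E'(3)] by blast
  qed
qed

lemma uniformity_base_ent_sw:
  assumes "bornology \<B>" and P: "P \<subseteq> pos_cont_fun" "P \<noteq> {}"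
    "\<And>\<epsilon>. \<epsilon> \<in> P \<Longrightarrow> (\<lambda>x. \<epsilon> x / 2) \<in> P"
    "\<And>\<epsilon> \<epsilon>'. \<epsilon> \<in> P \<Longrightarrow> \<epsilon>' \<in> P \<Longrightarrow> (\<lambda>x. min (\<epsilon> x) (\<epsilon>' x)) \<in> P"
  shows "uniformity_base cont_fun {ent_sw B \<epsilon> | B \<epsilon>. B \<in> \<B> \<and> \<epsilon> \<in> P}" (is "uniformity_base _ ?\<E>")
proof -
  have ne: "\<B> \<noteq> {}"
    using assms(1) by (auto simp: bornology_def)
  have un: "\<And>A B. A \<in> \<B> \<Longrightarrow> B \<in> \<B> \<Longrightarrow> A \<union> B \<in> \<B>"
    using assms(1) by (simp add: bornology_def)
  have pos: "\<And>\<epsilon> x. \<epsilon> \<in> P \<Longrightarrow> 0 < \<epsilon> x"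
    using P(1) by (auto simp: pos_cont_fun_def)
  show ?thesis
    unfolding uniformity_base_def
  proof (intro conjI ballI)
    show "?\<E> \<noteq> {}" using ne P(2) by blast
  next
    fix E assume "E \<in> ?\<E>"
    then obtain B \<epsilon> where E: "E = ent_sw B \<epsilon>" "B \<in> \<B>" "\<epsilon> \<in> P" by blast
    show "E \<subseteq> cont_fun \<times> cont_fun" "Id_on cont_fun \<subseteq> E"
      using pos[OF E(3)] by (auto simp: E(1) ent_sw_def intro: exI[of _ 1])
    have "E \<subseteq> E\<inverse>"
      by (auto simp: E(1) ent_sw_def abs_minus_commute)
    then show "\<exists>D\<in>?\<E>. D \<subseteq> E\<inverse>" using \<open>E \<in> ?\<E>\<close> by blast
    have "ent_sw B (\<lambda>x. \<epsilon> x / 2) O ent_sw B (\<lambda>x. \<epsilon> x / 2) \<subseteq> E"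
    proof (clarify)
      fix f g h
      assume "(f, g) \<in> ent_sw B (\<lambda>x. \<epsilon> x / 2)" "(g, h) \<in> ent_sw B (\<lambda>x. \<epsilon> x / 2)"
      then obtain \<delta> \<gamma> where C: "f \<in> cont_fun" "h \<in> cont_fun" "0 < \<delta>" "0 < \<gamma>"
        and d: "\<And>x. x \<in> enlargement B \<delta> \<Longrightarrow> \<bar>f x - g x\<bar> < \<epsilon> x / 2"
        and g: "\<And>x. x \<in> enlargement B \<gamma> \<Longrightarrow> \<bar>g x - h x\<bar> < \<epsilon> x / 2"
        unfolding ent_sw_def by blast
      have "\<bar>f x - h x\<bar> < \<epsilon> x" if "x \<in> enlargement B (min \<delta> \<gamma>)" for x
      proof -
        have "x \<in> enlargement B \<delta>" "x \<in> enlargement B \<gamma>"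
          using that enlargement_mono[of B B "min \<delta> \<gamma>" \<delta>]
            enlargement_mono[of B B "min \<delta> \<gamma>" \<gamma>] by auto
        from d[OF this(1)] g[OF this(2)] show ?thesis by linarith
      qed
      moreover have "0 < min \<delta> \<gamma>" using C by simp
      ultimately show "(f, h) \<in> E"
        using C unfolding E(1) ent_sw_def by blast
    qed
    then show "\<exists>D\<in>?\<E>. D O D \<subseteq> E" using E(2) P(3)[OF E(3)] by blast
    fix E' assume "E' \<in> ?\<E>"
    then obtain B' \<epsilon>' where E': "E' = ent_sw B' \<epsilon>'" "B' \<in> \<B>" "\<epsilon>' \<in> P" by blast
    have "ent_sw (B \<union> B') (\<lambda>x. min (\<epsilon> x) (\<epsilon>' x)) \<subseteq> E \<inter> E'"
    proof (clarify)
      fix f g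
      assume "(f, g) \<in> ent_sw (B \<union> B') (\<lambda>x. min (\<epsilon> x) (\<epsilon>' x))"
      then obtain \<delta> where C: "f \<in> cont_fun" "g \<in> cont_fun" "0 < \<delta>"
        and d: "\<And>x. x \<in> enlargement (B \<union> B') \<delta> \<Longrightarrow> \<bar>f x - g x\<bar> < min (\<epsilon> x) (\<epsilon>' x)"
        unfolding ent_sw_def by blast
      have "\<forall>x\<in>enlargement B \<delta>. \<bar>f x - g x\<bar> < \<epsilon> x"
           "\<forall>x\<in>enlargement B' \<delta>. \<bar>f x - g x\<bar> < \<epsilon>' x"
        using d by (simp_all add: enlargement_def)
      then show "(f, g) \<in> E \<inter> E'"
        using C unfolding E(1) E'(1) ent_sw_def by blast
    qed
    then show "\<exists>D\<in>?\<E>. D \<subseteq> E \<inter> E'"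
      using un[OF E(2) E'(2)] P(4)[OF E(3) E'(3)] by blast
  qed
qed

lemma uniformity_base_tau:
  assumes "bornology \<B>"
  shows "uniformity_base cont_fun {ent B \<epsilon> | B \<epsilon>. B \<in> \<B> \<and> 0 < \<epsilon>}"
proof -
  have "ent B \<epsilon> = ent_w B (\<lambda>_. \<epsilon>)" for B :: "'a set" and \<epsilon>
    by (simp add: ent_def ent_w_def)
  then have "{ent B \<epsilon> | B \<epsilon>. B \<in> \<B> \<and> 0 < \<epsilon>} =
        {ent_w B \<epsilon> | B \<epsilon>. B \<in> \<B> \<and> \<epsilon> \<in> (\<lambda>c _. c) ` {0<..}}"
    by (auto simp only: greaterThan_iff image_iff)
  moreover have "uniformity_base cont_fun \<dots>"
    by (rule uniformity_base_ent_w[OF assms]) (auto simp: pos_cont_fun_def image_iff fun_eq_iff intro: bexI[of _ "_ / 2"])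
  ultimately show ?thesis by simp
qed

lemma uniformity_base_tau_s:
  assumes "bornology \<B>"
  shows "uniformity_base cont_fun {ent_s B \<epsilon> | B \<epsilon>. B \<in> \<B> \<and> 0 < \<epsilon>}"
proof -
  have "ent_s B \<epsilon> = ent_sw B (\<lambda>_. \<epsilon>)" for B :: "'a set" and \<epsilon>
    by (simp add: ent_s_def ent_sw_def)
  then have "{ent_s B \<epsilon> | B \<epsilon>. B \<in> \<B> \<and> 0 < \<epsilon>} =
        {ent_sw B \<epsilon> | B \<epsilon>. B \<in> \<B> \<and> \<epsilon> \<in> (\<lambda>c _. c) ` {0<..}}"
    by (auto simp only: greaterThan_iff image_iff)
  moreover have "uniformity_base cont_fun \<dots>"
    by (rule uniformity_base_ent_sw[OF assms]) (auto simp: pos_cont_fun_def image_iff fun_eq_iff intro: bexI[of _ "_ / 2"])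
  ultimately show ?thesis by simp
qed

lemma uniformity_base_tau_w:
  assumes "bornology \<B>"
  shows "uniformity_base cont_fun {ent_w B \<epsilon> | B \<epsilon>. B \<in> \<B> \<and> \<epsilon> \<in> pos_cont_fun}"
  by (rule uniformity_base_ent_w[OF assms])
    (auto simp: pos_cont_fun_def intro!: continuous_on_divide continuous_on_min continuous_on_const exI[of _ "\<lambda>_. 1"])

lemma uniformity_base_tau_sw:
  assumes "bornology \<B>"
  shows "uniformity_base cont_fun {ent_sw B \<epsilon> | B \<epsilon>. B \<in> \<B> \<and> \<epsilon> \<in> pos_cont_fun}"
  by (rule uniformity_base_ent_sw[OF assms])
    (auto simp: pos_cont_fun_def intro!: continuous_on_divide continuous_on_min continuous_on_const exI[of _ "\<lambda>_. 1"])


section \<open>Cardinal invariants\<close>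

text \<open>
  Cardinals are represented by cardinal orders, compared by \<open>\<le>o\<close> and identified by \<open>=o\<close>.
  A nonempty family of cardinal orders has a least member, unique up to \<open>=o\<close>.
\<close>

definition min_card :: "'b rel set \<Rightarrow> 'b rel" where
  "min_card R = (SOME r. r \<in> R \<and> (\<forall>r'\<in>R. r \<le>o r'))"

lemma min_card:
  assumes "R \<noteq> {}" "\<And>r. r \<in> R \<Longrightarrow> Card_order r"
  shows "min_card R \<in> R" "r' \<in> R \<Longrightarrow> min_card R \<le>o r'"
proof -
  have "\<exists>r. r \<in> R \<and> (\<forall>r'\<in>R. r \<le>o r')"
    using exists_minim_Card_order[of R] assms by blast
  from someI_ex[OF this]
  show "min_card R \<in> R" "r' \<in> R \<Longrightarrow> min_card R \<le>o r'"
    unfolding min_card_def by blast+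
qed

definition topology_base :: "'y topology \<Rightarrow> 'y set set \<Rightarrow> bool" where
  "topology_base Y \<V> \<longleftrightarrow>
     (\<forall>V\<in>\<V>. openin Y V) \<and>
     (\<forall>U y. openin Y U \<and> y \<in> U \<longrightarrow> (\<exists>V\<in>\<V>. y \<in> V \<and> V \<subseteq> U))"

definition weight :: "'y topology \<Rightarrow> (nat + 'y set) rel" where
  "weight Y = natLeq +c min_card {|\<V>| | \<V>. topology_base Y \<V>}"

definition network :: "'y topology \<Rightarrow> 'y set set \<Rightarrow> bool" where
  "network Y \<N> \<longleftrightarrow>
     (\<forall>C\<in>\<N>. C \<subseteq> topspace Y \<and> C \<noteq> {}) \<and>
     (\<forall>U y. openin Y U \<and> y \<in> U \<longrightarrow> (\<exists>C\<in>\<N>. y \<in> C \<and> C \<subseteq> U))"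

definition network_weight :: "'y topology \<Rightarrow> (nat + 'y set) rel" where
  "network_weight Y = natLeq +c min_card {|\<N>| | \<N>. network Y \<N>}"

definition narrow :: "'y::group_add topology \<Rightarrow> 'b rel \<Rightarrow> bool" where
  "narrow Y \<kappa> \<longleftrightarrow>
     (\<forall>U. U \<subseteq> topspace Y \<and> (\<exists>V. openin Y V \<and> 0 \<in> V \<and> V \<subseteq> U) \<longrightarrow>
        (\<exists>S\<subseteq>topspace Y. |S| \<le>o \<kappa> \<and> topspace Y = {u + s | u s. u \<in> U \<and> s \<in> S}))"

text \<open>
  Infinite cardinals on the type \<open>nat + 'y\<close> suffice for the minimum: \<open>Y\<close> is \<open>\<kappa>\<close>-narrow for
  \<open>\<kappa>\<close> the cardinality of that type, and every smaller cardinal is represented on it.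
\<close>

definition narrowness_index :: "'y::group_add topology \<Rightarrow> (nat + (nat + 'y)) rel" where
  "narrowness_index Y =
     natLeq +c min_card {\<kappa> :: (nat + 'y) rel. Card_order \<kappa> \<and> cinfinite \<kappa> \<and> narrow Y \<kappa>}"

end

theory Submission
  imports Defs
begin

text \<open>
  Multiplication by a function \<open>e\<close> in \<open>C\<^sup>+(X)\<close> is an automorphism of the group \<open>C(X)\<close> that carries
  \<open>{g. \<bar>g\<bar> < 1}\<close> to \<open>{g. \<bar>g\<bar> < e}\<close>, pointwise and therefore on any set. It transports statements
  about uniform neighbourhoods to statements about the neighbourhoods of radius \<open>e\<close>, and this is
  the main reason why the fine topology \<open>\<tau>\<^sup>w\<close> or \<open>\<tau>\<^sup>s\<^sup>w\<close> has the same invariants as the coarser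
  uniform topology \<open>\<tau>\<close> or \<open>\<tau>\<^sup>s\<close>. All balls below are to be read along \<open>B\<close> or along its enlargements.

  Narrowness: if the translates of \<open>{g. \<bar>g\<bar> < 1}\<close> by the members of \<open>S\<close> cover \<open>C(X)\<close>, then so do the
  translates of \<open>{g. \<bar>g\<bar> < e}\<close> by the members of \<open>e S\<close>, a set that is not larger
  (\<open>narrow_fine_iff\<close>).

  Network weight, and one half of weight: by the same scaling, the sets \<open>e C\<close> with \<open>C\<close> in a network
  or base of the uniform topology and \<open>e\<close> in \<open>C\<^sup>+(X)\<close> form a network or base of the fine topology.
  Few \<open>e\<close> suffice. Choosing a point in each member of the network gives a dense set \<open>D\<close>; for
  \<open>\<epsilon>\<close> in \<open>C\<^sup>+(X)\<close> some \<open>s\<close> in \<open>D\<close> is within \<open>1\<close> of \<open>- ln \<epsilon>\<close>, and then \<open>exp (- s - 1) < \<epsilon>\<close>. So it is enough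
  to scale by the functions \<open>exp (- s - 1)\<close> with \<open>s\<close> in \<open>D\<close> (\<open>scalings_refine\<close>).

  The other half of weight does not follow from comparing the topologies, since weight is not
  monotone. A base of the fine topology provides a dense set and, through its members that contain
  \<open>0\<close>, a small family of sets \<open>B'\<close> in the bornology. This family is cofinal for uniform
  approximation: if every \<open>g\<close> that is smaller than \<open>\<epsilon>\<close> on \<open>B'\<close> is smaller than \<open>1\<close> on \<open>B\<close>, then a bound
  \<open>\<eta>\<close> on \<open>B'\<close> implies the bound \<open>2 \<eta>\<close> on \<open>B\<close> (\<open>uniform_bound_transfer\<close>). Balls of radius \<open>1 / (n + 1)\<close>
  around points of the dense set, taken with respect to such \<open>B'\<close>, hence form a base of the uniform
  topology (\<open>weight_unif_le\<close>).
\<close>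

section \<open>Neighbourhoods in a topology given by entourages\<close>

lemma in_interior_of_entourage_topology:
  assumes base: "uniformity_base S \<E>" and E: "E \<in> \<E>" "f \<in> S" "E `` {f} \<subseteq> A"
  shows "f \<in> entourage_topology S \<E> interior_of A"
proof -
  \<comment> \<open>\<open>W\<close> is the interior of \<open>A\<close>: it is open because every entourage contains some \<open>D O D\<close>.\<close>
  define W where "W = {g \<in> S. \<exists>E\<in>\<E>. E `` {g} \<subseteq> A}"
  have "W \<subseteq> A"
    using base by (fastforce simp: W_def uniformity_base_def)
  moreover have "openin (entourage_topology S \<E>) W"
    unfolding openin_entourage_topology[OF base]
  proof (intro conjI ballI)
    show "W \<subseteq> S" by (auto simp: W_def)
    fix g assume "g \<in> W"
    then obtain E where E: "E \<in> \<E>" "E `` {g} \<subseteq> A" by (auto simp: W_def)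
    obtain D where D: "D \<in> \<E>" "D O D \<subseteq> E"
      using base E(1) by (meson uniformity_base_def)
    have "D \<subseteq> S \<times> S" using base D(1) by (auto simp: uniformity_base_def)
    then have "D `` {g} \<subseteq> W" using D E(2) unfolding W_def by blast
    then show "\<exists>E\<in>\<E>. E `` {g} \<subseteq> W" using D(1) by blast
  qed
  moreover have "f \<in> W" using E by (auto simp: W_def)
  ultimately show ?thesis by (meson interior_of_maximal subsetD)
qed

section \<open>Comparing weights and network weights\<close>

lemma natLeq_csum_mono:
  assumes "r \<le>o natLeq +c q" and "Card_order r"
  shows "natLeq +c r \<le>o natLeq +c q"
  using assms
  by (intro csum_cinfinite_bound)
    (auto simp: cinfinite_csum natLeq_cinfinite natLeq_Card_order Card_order_csum ordLeq_csum1)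

lemma card_of_Times_ordLeq_natLeq_csum:
  assumes "|A| \<le>o natLeq +c q" and "|B| \<le>o natLeq +c q"
  shows "|A \<times> B| \<le>o natLeq +c q"
  using cprod_cinfinite_bound[OF assms card_of_Card_order card_of_Card_order]
  by (simp add: cprod_def cinfinite_csum natLeq_cinfinite Card_order_csum Field_card_of)

lemma ordLeq_natLeq_csum: "|A| \<le>o natLeq +c |A|"
  by (simp add: ordLeq_csum2 card_of_Card_order)

text \<open>
  Weight and network weight are both minima over families with a given property, with \<open>\<aleph>\<^sub>0\<close> added.
  Because of that summand, they are compared by any construction that indexes the new family by
  products of the old one with itself and with countable sets.
\<close>

lemma natLeq_csum_min_card_ordLeq:
  assumes ne: "\<exists>\<V>. P \<V>"
    and step: "\<And>\<V>. P \<V> \<Longrightarrow> \<exists>\<V>'. Q \<V>' \<and> |\<V>'| \<le>o natLeq +c |\<V>|"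
  shows "natLeq +c min_card {|\<V>| | \<V>. Q \<V>} \<le>o natLeq +c min_card {|\<V>| | \<V>. P \<V>}"
proof -
  have neP: "{|\<V>| | \<V>. P \<V>} \<noteq> {}" and neQ: "{|\<V>| | \<V>. Q \<V>} \<noteq> {}"
    using ne step by blast+
  have card: "\<And>R r. r \<in> {|\<V>| | \<V>. R \<V>} \<Longrightarrow> Card_order r"
    by (auto simp: card_of_Card_order)
  obtain \<V> where \<V>: "P \<V>" "min_card {|\<V>| | \<V>. P \<V>} = |\<V>|"
    using min_card(1)[OF neP card] by blast
  obtain \<V>' where \<V>': "Q \<V>'" "|\<V>'| \<le>o natLeq +c |\<V>|"
    using step[OF \<V>(1)] by blast
  have "min_card {|\<V>| | \<V>. Q \<V>} \<le>o |\<V>'|"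
    using \<V>'(1) by (intro min_card(2)[OF neQ card]) auto
  then have "min_card {|\<V>| | \<V>. Q \<V>} \<le>o natLeq +c |\<V>|"
    using \<V>'(2) by (rule ordLeq_transitive)
  then show ?thesis
    unfolding \<V>(2) by (rule natLeq_csum_mono) (rule card[OF min_card(1)[OF neQ card]])
qed

lemma weight_ordLeqI:
  assumes "\<And>\<V>. topology_base Y \<V> \<Longrightarrow> \<exists>\<V>'. topology_base Z \<V>' \<and> |\<V>'| \<le>o natLeq +c |\<V>|"
  shows "weight Z \<le>o weight Y"
  unfolding weight_def
proof (rule natLeq_csum_min_card_ordLeq[OF _ assms])
  have "topology_base Y {U. openin Y U}" by (auto simp: topology_base_def)
  then show "\<exists>\<V>. topology_base Y \<V>" ..
qed

lemma network_weight_ordLeqI: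
  assumes "\<And>\<N>. network Y \<N> \<Longrightarrow> \<exists>\<N>'. network Z \<N>' \<and> |\<N>'| \<le>o natLeq +c |\<N>|"
  shows "network_weight Z \<le>o network_weight Y"
  unfolding network_weight_def
proof (rule natLeq_csum_min_card_ordLeq[OF _ assms])
  have "network Y {C. C \<subseteq> topspace Y \<and> C \<noteq> {}}"
    unfolding network_def by (blast dest: openin_subset)
  then show "\<exists>\<N>. network Y \<N>" ..
qed

lemma network_topology_base:
  "topology_base Y \<V> \<Longrightarrow> network Y (\<V> - {{}})"
  unfolding topology_base_def network_def by (blast dest: openin_subset)

lemma dense_subset_of_network:
  assumes "network Y \<N>"
  obtains D where "D \<subseteq> topspace Y" "|D| \<le>o |\<N>|"
    "Y closure_of D = topspace Y"
proof
  define c where "c C = (SOME y. y \<in> C)" for C :: "'a set"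
  have c: "c C \<in> C" if "C \<in> \<N>" for C
    using assms that by (auto simp: network_def c_def some_in_eq)
  show "c ` \<N> \<subseteq> topspace Y" using c assms by (auto simp: network_def)
  show "|c ` \<N>| \<le>o |\<N>|" by (rule card_of_image)
  show "Y closure_of c ` \<N> = topspace Y"
    unfolding dense_intersects_open using assms c unfolding network_def by blast
qed

section \<open>Scaling continuous functions by positive ones\<close>

lemma mult_in_cont_fun: "e \<in> pos_cont_fun \<Longrightarrow> f \<in> cont_fun \<Longrightarrow> e * f \<in> cont_fun"
  by (auto simp: cont_fun_def pos_cont_fun_def times_fun_def intro!: continuous_intros)

lemma divide_in_cont_fun: "e \<in> pos_cont_fun \<Longrightarrow> f \<in> cont_fun \<Longrightarrow> (\<lambda>x. f x / e x) \<in> cont_fun"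
  by (auto simp: cont_fun_def pos_cont_fun_def less_imp_neq[symmetric] dual_order.strict_implies_not_eq
      intro!: continuous_on_divide)

lemma pos_cont_fun_pos: "e \<in> pos_cont_fun \<Longrightarrow> 0 < e x"
  by (simp add: pos_cont_fun_def)

lemma abs_diff_mult_less_iff:
  fixes e :: real
  assumes "0 < e"
  shows "\<bar>e * a - e * b\<bar> < e * c \<longleftrightarrow> \<bar>a - b\<bar> < c"
  using assms by (simp add: abs_mult flip: right_diff_distrib)

lemma mult_divide_cancel_fun:
  "e \<in> pos_cont_fun \<Longrightarrow> e * (\<lambda>x. f x / e x) = f"
  using pos_cont_fun_pos[of e] by (auto simp: times_fun_def fun_eq_iff dual_order.strict_implies_not_eq)

text \<open>
  The map \<open>\<epsilon> \<mapsto> - ln \<epsilon>\<close> identifies radii in \<open>C\<^sup>+(X)\<close> with members of \<open>C(X)\<close>. A function \<open>s\<close> within \<open>1\<close> of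
  \<open>- ln \<epsilon>\<close> satisfies \<open>exp (- s - 1) < \<epsilon>\<close>, so uniform density in \<open>C(X)\<close> provides arbitrarily small
  radii; the summand \<open>- 1\<close> absorbs the error of approximation.
\<close>

definition minorant :: "('a \<Rightarrow> real) \<Rightarrow> 'a \<Rightarrow> real" where
  "minorant s x = exp (- s x - 1)"

lemma minorant_in_pos_cont_fun: "s \<in> cont_fun \<Longrightarrow> minorant s \<in> pos_cont_fun"
  by (auto simp: cont_fun_def pos_cont_fun_def minorant_def intro!: continuous_intros)

definition scalings :: "('a \<Rightarrow> real) set \<Rightarrow> ('a \<Rightarrow> real) set set \<Rightarrow> ('a \<Rightarrow> real) set set" where
  "scalings D \<N> = (\<lambda>(s, C). (*) (minorant s) ` C) ` (D \<times> \<N>)"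

lemma card_of_scalings:
  assumes "|D| \<le>o |\<N>|"
  shows "|scalings D \<N>| \<le>o natLeq +c |\<N>|"
proof -
  have "|D \<times> \<N>| \<le>o natLeq +c |\<N>|"
    using ordLeq_transitive[OF assms ordLeq_natLeq_csum] ordLeq_natLeq_csum
    by (rule card_of_Times_ordLeq_natLeq_csum)
  with card_of_image show ?thesis
    unfolding scalings_def by (rule ordLeq_transitive)
qed

section \<open>Uniform and fine approximation along filters\<close>

text \<open>
  Approximation on a set \<open>B\<close> and approximation on some enlargement of \<open>B\<close> are both approximation
  along a filter, the principal filter of \<open>B\<close> and the filter generated by the enlargements.
  For the family of filters of the first kind, the topologies \<open>T_unif\<close> and \<open>T_fine\<close> below are \<open>\<tau>\<close> and
  \<open>\<tau>\<^sup>w\<close>, for the second kind they are \<open>\<tau>\<^sup>s\<close> and \<open>\<tau>\<^sup>s\<^sup>w\<close>, so that one proof serves both pairs.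
\<close>

definition filter_ent ::
  "'a::metric_space filter \<Rightarrow> ('a \<Rightarrow> real) \<Rightarrow> (('a \<Rightarrow> real) \<times> ('a \<Rightarrow> real)) set" where
  "filter_ent F \<epsilon> =
     {(f, g) \<in> cont_fun \<times> cont_fun. \<forall>\<^sub>F x in F. \<bar>f x - g x\<bar> < \<epsilon> x}"

definition uniform_ents where
  "uniform_ents \<F> = {filter_ent F (\<lambda>_. c) | F c. F \<in> \<F> \<and> 0 < c}"

definition fine_ents where
  "fine_ents \<F> = {filter_ent F \<epsilon> | F \<epsilon>. F \<in> \<F> \<and> \<epsilon> \<in> pos_cont_fun}"

text \<open>
  This is how a fine neighbourhood of zero controls uniform ones. The part of \<open>\<bar>g\<bar>\<close> that exceeds
  \<open>\<eta>\<close> vanishes along \<open>G\<close>, hence it satisfies the hypothesis of \<open>absorb\<close> after multiplication by any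
  constant, however small \<open>\<epsilon>\<close> is; the factor \<open>1 / \<eta>\<close> shows that this excess is below \<open>\<eta>\<close> along \<open>F\<close>.
\<close>

lemma uniform_bound_transfer:
  assumes absorb: "\<And>g. g \<in> cont_fun \<Longrightarrow> \<forall>\<^sub>F x in G. \<bar>g x\<bar> < \<epsilon> x \<Longrightarrow> \<forall>\<^sub>F x in F. \<bar>g x\<bar> < 1"
    and \<epsilon>: "\<epsilon> \<in> pos_cont_fun" and g: "g \<in> cont_fun" and \<eta>: "0 < \<eta>"
    and bound: "\<forall>\<^sub>F x in G. \<bar>g x\<bar> < \<eta>"
  shows "\<forall>\<^sub>F x in F. \<bar>g x\<bar> < 2 * \<eta>"
proof -
  define h where "h x = max 0 (\<bar>g x\<bar> - \<eta>) / \<eta>" for x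
  have "h \<in> cont_fun"
    using g \<eta> by (auto simp: h_def cont_fun_def intro!: continuous_intros)
  moreover have "\<forall>\<^sub>F x in G. \<bar>h x\<bar> < \<epsilon> x"
    using bound by (rule eventually_mono) (simp add: h_def pos_cont_fun_pos[OF \<epsilon>])
  ultimately have "\<forall>\<^sub>F x in F. \<bar>h x\<bar> < 1" by (rule absorb)
  then show ?thesis
    by (rule eventually_mono) (use \<eta> in \<open>auto simp: h_def field_simps max_def split: if_splits\<close>)
qed

locale filter_uniformities =
  fixes \<F> :: "'a::metric_space filter set"
  assumes uniform_base: "uniformity_base cont_fun (uniform_ents \<F>)"
    and fine_base: "uniformity_base cont_fun (fine_ents \<F>)"
begin

abbreviation "T_unif \<equiv> entourage_topology cont_fun (uniform_ents \<F>)"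
abbreviation "T_fine \<equiv> entourage_topology cont_fun (fine_ents \<F>)"

lemma topspace_unif: "topspace T_unif = cont_fun" and topspace_fine: "topspace T_fine = cont_fun"
  by (simp_all add: topspace_entourage_topology uniform_base fine_base)

lemma openin_unifE:
  assumes "openin T_unif U" "f \<in> U"
  obtains F c where "F \<in> \<F>" "0 < c"
    "\<And>g. g \<in> cont_fun \<Longrightarrow> \<forall>\<^sub>F x in F. \<bar>f x - g x\<bar> < c \<Longrightarrow> g \<in> U"
  using assms unfolding openin_entourage_topology[OF uniform_base]
  by (fastforce simp: uniform_ents_def filter_ent_def)

lemma openin_fineE:
  assumes "openin T_fine U" "f \<in> U"
  obtains F \<epsilon> where "F \<in> \<F>" "\<epsilon> \<in> pos_cont_fun"
    "\<And>g. g \<in> cont_fun \<Longrightarrow> \<forall>\<^sub>F x in F. \<bar>f x - g x\<bar> < \<epsilon> x \<Longrightarrow> g \<in> U"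
  using assms unfolding openin_entourage_topology[OF fine_base]
  by (fastforce simp: fine_ents_def filter_ent_def)

lemma interior_of_unifI:
  assumes "F \<in> \<F>" "0 < c" "f \<in> cont_fun"
    "\<And>g. g \<in> cont_fun \<Longrightarrow> \<forall>\<^sub>F x in F. \<bar>f x - g x\<bar> < c \<Longrightarrow> g \<in> A"
  shows "f \<in> T_unif interior_of A"
  using assms
  by (intro in_interior_of_entourage_topology[OF uniform_base, of "filter_ent F (\<lambda>_. c)"])
    (auto simp: uniform_ents_def filter_ent_def)

lemma openin_fineI:
  assumes "U \<subseteq> cont_fun"
    "\<And>f. f \<in> U \<Longrightarrow> \<exists>F\<in>\<F>. \<exists>\<epsilon>\<in>pos_cont_fun.
       \<forall>g\<in>cont_fun. (\<forall>\<^sub>F x in F. \<bar>f x - g x\<bar> < \<epsilon> x) \<longrightarrow> g \<in> U"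
  shows "openin T_fine U"
  unfolding openin_entourage_topology[OF fine_base]
proof (intro conjI ballI assms(1))
  fix f assume "f \<in> U"
  from assms(2)[OF this] obtain F \<epsilon> where "F \<in> \<F>" "\<epsilon> \<in> pos_cont_fun"
    "\<forall>g\<in>cont_fun. (\<forall>\<^sub>F x in F. \<bar>f x - g x\<bar> < \<epsilon> x) \<longrightarrow> g \<in> U"
    by blast
  then show "\<exists>E\<in>fine_ents \<F>. E `` {f} \<subseteq> U"
    by (intro bexI[of _ "filter_ent F \<epsilon>"]) (auto simp: fine_ents_def filter_ent_def)
qed

lemma openin_fine_if_openin_unif:
  assumes "openin T_unif U"
  shows "openin T_fine U"
proof (rule openin_fineI)
  show "U \<subseteq> cont_fun" using openin_subset[OF assms] by (simp add: topspace_unif)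
  fix f assume "f \<in> U"
  with assms obtain F c where "F \<in> \<F>" "0 < c"
    "\<And>g. g \<in> cont_fun \<Longrightarrow> \<forall>\<^sub>F x in F. \<bar>f x - g x\<bar> < c \<Longrightarrow> g \<in> U"
    by (rule openin_unifE) blast
  then show "\<exists>F\<in>\<F>. \<exists>\<epsilon>\<in>pos_cont_fun.
       \<forall>g\<in>cont_fun. (\<forall>\<^sub>F x in F. \<bar>f x - g x\<bar> < \<epsilon> x) \<longrightarrow> g \<in> U"
    by (intro bexI[of _ F] bexI[of _ "\<lambda>_. c"]) (auto simp: pos_cont_fun_def)
qed

section \<open>Narrowness\<close>

text \<open>
  If \<open>f / e\<close> is within \<open>1\<close> of \<open>s\<close> along a filter, then \<open>f\<close> is within \<open>e\<close> of \<open>e * s\<close>.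
\<close>

lemma narrow_fine_iff: "narrow T_fine \<kappa> \<longleftrightarrow> narrow T_unif \<kappa>"
proof
  assume "narrow T_fine \<kappa>"
  then show "narrow T_unif \<kappa>"
    using openin_fine_if_openin_unif unfolding narrow_def topspace_unif topspace_fine by meson
next
  assume narrow: "narrow T_unif \<kappa>"
  show "narrow T_fine \<kappa>"
    unfolding narrow_def topspace_fine
  proof (intro allI impI, elim conjE exE)
    fix U V assume U: "U \<subseteq> cont_fun" and V: "openin T_fine V" "0 \<in> V" "V \<subseteq> U"
    obtain F e where F: "F \<in> \<F>" and e: "e \<in> pos_cont_fun"
      and ball: "\<And>g. g \<in> cont_fun \<Longrightarrow> \<forall>\<^sub>F x in F. \<bar>0 x - g x\<bar> < e x \<Longrightarrow> g \<in> V"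
      by (rule openin_fineE[OF V(1,2)]) blast
    define W where "W = {g \<in> cont_fun. \<forall>\<^sub>F x in F. \<bar>g x\<bar> < 1}"
    have "0 \<in> T_unif interior_of W"
      by (rule interior_of_unifI[OF F zero_less_one]) (auto simp: W_def cont_fun_def zero_fun_def)
    then have "\<exists>V. openin T_unif V \<and> 0 \<in> V \<and> V \<subseteq> W"
      by (meson interior_of_subset openin_interior_of)
    moreover have "W \<subseteq> cont_fun" by (auto simp: W_def)
    ultimately obtain S where S: "S \<subseteq> cont_fun" "|S| \<le>o \<kappa>"
      "cont_fun = {u + s | u s. u \<in> W \<and> s \<in> S}"
      using narrow unfolding narrow_def topspace_unif by meson
    show "\<exists>S\<subseteq>cont_fun. |S| \<le>o \<kappa> \<and> cont_fun = {u + s |u s. u \<in> U \<and> s \<in> S}"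
    proof (intro exI conjI)
      show sub: "(*) e ` S \<subseteq> cont_fun" using S(1) mult_in_cont_fun[OF e] by blast
      show "|(*) e ` S| \<le>o \<kappa>" using card_of_image S(2) by (rule ordLeq_transitive)
      show "cont_fun = {u + s |u s. u \<in> U \<and> s \<in> (*) e ` S}"
      proof (intro equalityI subsetI)
        fix f :: "'a \<Rightarrow> real" assume "f \<in> cont_fun"
        then have "(\<lambda>x. f x / e x) \<in> cont_fun" by (rule divide_in_cont_fun[OF e])
        then obtain u s where us: "u \<in> W" "s \<in> S" "(\<lambda>x. f x / e x) = u + s"
          using S(3) by blast
        then have "f = e * u + e * s"
          using mult_divide_cancel_fun[OF e, of f] by (simp add: distrib_left)
        moreover have "e * u \<in> U"
        proof -
          have "e * u \<in> V"
          proof (rule ball)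
            show "e * u \<in> cont_fun" using us(1) by (intro mult_in_cont_fun[OF e]) (simp add: W_def)
            have "\<forall>\<^sub>F x in F. \<bar>u x\<bar> < 1" using us(1) by (simp add: W_def)
            then show "\<forall>\<^sub>F x in F. \<bar>0 x - (e * u) x\<bar> < e x"
              by (rule eventually_mono)
                (simp add: abs_mult abs_of_pos[OF pos_cont_fun_pos[OF e]] pos_cont_fun_pos[OF e])
          qed
          then show ?thesis using V(3) by blast
        qed
        ultimately show "f \<in> {u + s |u s. u \<in> U \<and> s \<in> (*) e ` S}" using us(2) by blast
      next
        fix f assume "f \<in> {u + s |u s. u \<in> U \<and> s \<in> (*) e ` S}"
        then show "f \<in> cont_fun"
          using U sub by (auto simp: cont_fun_def plus_fun_def subset_iff intro!: continuous_on_add)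
      qed
    qed
  qed
qed

section \<open>Scaling a network\<close>

lemma minorant_below_on_dense:
  assumes dense: "T_unif closure_of D = topspace T_unif"
    and F: "F \<in> \<F>" and \<epsilon>: "\<epsilon> \<in> pos_cont_fun"
  obtains s where "s \<in> D" "\<forall>\<^sub>F x in F. minorant s x < \<epsilon> x"
proof -
  define u where "u x = - ln (\<epsilon> x)" for x
  have u: "u \<in> cont_fun"
    using \<epsilon> by (auto simp: cont_fun_def pos_cont_fun_def u_def dual_order.strict_implies_not_eq
        intro!: continuous_intros)
  define A where "A = {s. \<forall>\<^sub>F x in F. \<bar>u x - s x\<bar> < 1}"
  have "u \<in> T_unif interior_of A"
    by (rule interior_of_unifI[OF F zero_less_one u]) (simp add: A_def)
  then obtain s where s: "s \<in> D" "s \<in> T_unif interior_of A"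
    using dense openin_interior_of[of T_unif A] unfolding dense_intersects_open by blast
  then have "\<forall>\<^sub>F x in F. \<bar>u x - s x\<bar> < 1"
    using interior_of_subset[of T_unif A] by (auto simp: A_def)
  then have "\<forall>\<^sub>F x in F. minorant s x < \<epsilon> x"
  proof (rule eventually_mono)
    fix x assume "\<bar>u x - s x\<bar> < 1"
    then have "- s x - 1 < ln (\<epsilon> x)" by (simp add: u_def)
    then have "minorant s x < exp (ln (\<epsilon> x))" by (simp add: minorant_def del: exp_ln)
    then show "minorant s x < \<epsilon> x" using pos_cont_fun_pos[OF \<epsilon>] by simp
  qed
  with s(1) show ?thesis by (rule that)
qed

text \<open>
  To find a set between \<open>f\<close> and its neighbourhood of radius \<open>\<epsilon>\<close>, choose a minorant \<open>e\<close> below \<open>\<epsilon>\<close> and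
  a set of the network between \<open>f / e\<close> and its uniform neighbourhood of radius \<open>1\<close>, and multiply
  by \<open>e\<close>.
\<close>

lemma scalings_refine:
  assumes dense: "T_unif closure_of D = topspace T_unif"
    and D: "D \<subseteq> cont_fun"
    and \<N>: "\<forall>U y. openin T_unif U \<and> y \<in> U \<longrightarrow> (\<exists>C\<in>\<N>. y \<in> C \<and> C \<subseteq> U)"
    and U: "openin T_fine U" "f \<in> U"
  shows "\<exists>A\<in>scalings D \<N>. f \<in> A \<and> A \<subseteq> U"
proof -
  have f: "f \<in> cont_fun" using openin_subset[OF U(1)] U(2) by (auto simp: topspace_fine)
  obtain F \<epsilon> where F: "F \<in> \<F>" and \<epsilon>: "\<epsilon> \<in> pos_cont_fun"
    and ball: "\<And>g. g \<in> cont_fun \<Longrightarrow> \<forall>\<^sub>F x in F. \<bar>f x - g x\<bar> < \<epsilon> x \<Longrightarrow> g \<in> U"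
    by (rule openin_fineE[OF U]) blast
  obtain s where s: "s \<in> D" "\<forall>\<^sub>F x in F. minorant s x < \<epsilon> x"
    by (rule minorant_below_on_dense[OF dense F \<epsilon>]) blast
  have e: "minorant s \<in> pos_cont_fun" by (rule minorant_in_pos_cont_fun[OF subsetD[OF D s(1)]])
  define h where "h x = f x / minorant s x" for x
  have h: "h \<in> cont_fun" unfolding h_def by (rule divide_in_cont_fun[OF e f])
  have eh: "minorant s * h = f" unfolding h_def by (rule mult_divide_cancel_fun[OF e])
  define A where "A = {g \<in> cont_fun. \<forall>\<^sub>F x in F. \<bar>h x - g x\<bar> < 1}"
  have "h \<in> T_unif interior_of A"
    by (rule interior_of_unifI[OF F zero_less_one h]) (simp add: A_def)
  with \<N> openin_interior_of[of T_unif A] obtain C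
    where C: "C \<in> \<N>" "h \<in> C" "C \<subseteq> T_unif interior_of A"
    by blast
  from C(3) have CA: "C \<subseteq> A" using interior_of_subset by (rule subset_trans)
  have "minorant s * g \<in> U" if "g \<in> C" for g
  proof (rule ball)
    have g: "g \<in> cont_fun" "\<forall>\<^sub>F x in F. \<bar>h x - g x\<bar> < 1" using that CA by (auto simp: A_def)
    show "minorant s * g \<in> cont_fun" by (rule mult_in_cont_fun[OF e g(1)])
    show "\<forall>\<^sub>F x in F. \<bar>f x - (minorant s * g) x\<bar> < \<epsilon> x"
      using g(2) s(2)
    proof eventually_elim
      case (elim x)
      have "\<bar>minorant s x * h x - minorant s x * g x\<bar> < minorant s x * 1"
        using elim(1) by (simp only: abs_diff_mult_less_iff[OF pos_cont_fun_pos[OF e]])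
      then have "\<bar>f x - (minorant s * g) x\<bar> < minorant s x"
        by (simp add: eh[symmetric])
      with elim(2) show ?case by simp
    qed
  qed
  then have "(*) (minorant s) ` C \<subseteq> U" by (rule image_subsetI)
  moreover have "f \<in> (*) (minorant s) ` C" using C(2) eh by (intro image_eqI[of _ _ h]) simp_all
  moreover have "(*) (minorant s) ` C \<in> scalings D \<N>"
    unfolding scalings_def using s(1) C(1) by (intro image_eqI[of _ _ "(s, C)"]) simp_all
  ultimately show ?thesis by (intro bexI[of _ "(*) (minorant s) ` C"] conjI)
qed

lemma network_weight_fine_eq: "network_weight T_fine =o network_weight T_unif"
proof -
  have "network_weight T_fine \<le>o network_weight T_unif"
  proof (rule network_weight_ordLeqI)
    fix \<N> assume \<N>: "network T_unif \<N>"
    obtain D where D: "D \<subseteq> topspace T_unif" "|D| \<le>o |\<N>|"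
      "T_unif closure_of D = topspace T_unif"
      by (rule dense_subset_of_network[OF \<N>]) blast
    note D_cont = D(1)[unfolded topspace_unif]
    have "network T_fine (scalings D \<N>)"
      unfolding network_def
    proof (intro conjI ballI allI impI)
      fix A assume "A \<in> scalings D \<N>"
      then obtain s C where A: "s \<in> D" "C \<in> \<N>" "A = (*) (minorant s) ` C"
        by (auto simp: scalings_def)
      have "minorant s \<in> pos_cont_fun" by (rule minorant_in_pos_cont_fun[OF subsetD[OF D_cont A(1)]])
      moreover have C: "C \<subseteq> cont_fun" "C \<noteq> {}"
        using \<N> A(2) by (simp_all add: network_def topspace_unif)
      ultimately show "A \<subseteq> topspace T_fine"
        unfolding A(3) topspace_fine by (auto intro!: mult_in_cont_fun)
      show "A \<noteq> {}" using A(3) C(2) by blast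
    next
      fix U f assume "openin T_fine U \<and> f \<in> U"
      then show "\<exists>A\<in>scalings D \<N>. f \<in> A \<and> A \<subseteq> U"
        using \<N> by (intro scalings_refine[OF D(3) D_cont]) (simp_all add: network_def)
    qed
    with card_of_scalings[OF D(2)]
    show "\<exists>\<N>'. network T_fine \<N>' \<and> |\<N>'| \<le>o natLeq +c |\<N>|"
      by (intro exI conjI)
  qed
  moreover have "network_weight T_unif \<le>o network_weight T_fine"
  proof (rule network_weight_ordLeqI)
    fix \<N> assume "network T_fine \<N>"
    then have "network T_unif \<N>"
      unfolding network_def topspace_unif topspace_fine by (simp add: openin_fine_if_openin_unif)
    with ordLeq_natLeq_csum show "\<exists>\<N>'. network T_unif \<N>' \<and> |\<N>'| \<le>o natLeq +c |\<N>|"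
      by (intro exI conjI)
  qed
  ultimately show ?thesis by (simp add: ordIso_iff_ordLeq)
qed

section \<open>Weight\<close>

text \<open>
  A scaled member of a base has to be open for the fine topology. It is, because scaling by \<open>e\<close>
  turns a uniform radius \<open>c\<close> into the radius \<open>e * c\<close>.
\<close>

lemma openin_fine_scaling:
  assumes e: "e \<in> pos_cont_fun" and V: "openin T_unif V"
  shows "openin T_fine ((*) e ` V)"
proof (rule openin_fineI)
  have Vc: "V \<subseteq> cont_fun" using openin_subset[OF V] by (simp add: topspace_unif)
  then show "(*) e ` V \<subseteq> cont_fun" by (intro image_subsetI mult_in_cont_fun[OF e]) blast
  fix f assume "f \<in> (*) e ` V"
  then obtain v where v: "v \<in> V" "f = e * v" by (elim imageE)
  obtain F c where F: "F \<in> \<F>" "0 < c"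
    and ball: "\<And>g. g \<in> cont_fun \<Longrightarrow> \<forall>\<^sub>F x in F. \<bar>v x - g x\<bar> < c \<Longrightarrow> g \<in> V"
    by (rule openin_unifE[OF V v(1)]) blast
  have "g \<in> (*) e ` V" if g: "g \<in> cont_fun" "\<forall>\<^sub>F x in F. \<bar>f x - g x\<bar> < e x * c" for g
  proof -
    define h where "h x = g x / e x" for x
    have eh: "e * h = g" unfolding h_def by (rule mult_divide_cancel_fun[OF e])
    have "h \<in> V"
    proof (rule ball)
      show "h \<in> cont_fun" unfolding h_def by (rule divide_in_cont_fun[OF e g(1)])
      show "\<forall>\<^sub>F x in F. \<bar>v x - h x\<bar> < c"
        using g(2) unfolding v(2) eh[symmetric] times_fun_def
        by (simp only: abs_diff_mult_less_iff[OF pos_cont_fun_pos[OF e]])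
    qed
    then show ?thesis using eh by (intro image_eqI[of _ _ h]) simp_all
  qed
  moreover have "(\<lambda>x. e x * c) \<in> pos_cont_fun"
    using e F(2) by (auto simp: pos_cont_fun_def intro!: continuous_intros)
  ultimately show "\<exists>F\<in>\<F>. \<exists>\<epsilon>\<in>pos_cont_fun.
      \<forall>g\<in>cont_fun. (\<forall>\<^sub>F x in F. \<bar>f x - g x\<bar> < \<epsilon> x) \<longrightarrow> g \<in> (*) e ` V"
    using F(1) by (intro bexI[of _ F] bexI[of _ "\<lambda>x. e x * c"] ballI impI)
qed

lemma weight_fine_le: "weight T_fine \<le>o weight T_unif"
proof (rule weight_ordLeqI)
  fix \<V> assume \<V>: "topology_base T_unif \<V>"
  obtain D where D: "D \<subseteq> topspace T_unif" "|D| \<le>o |\<V> - {{}}|"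
    "T_unif closure_of D = topspace T_unif"
    by (rule dense_subset_of_network[OF network_topology_base[OF \<V>]]) blast
  note D_cont = D(1)[unfolded topspace_unif]
  have "topology_base T_fine (scalings D \<V>)"
    unfolding topology_base_def
  proof (intro conjI ballI allI impI)
    fix A assume "A \<in> scalings D \<V>"
    then obtain s V where A: "s \<in> D" "V \<in> \<V>" "A = (*) (minorant s) ` V"
      by (auto simp: scalings_def)
    have "minorant s \<in> pos_cont_fun" by (rule minorant_in_pos_cont_fun[OF subsetD[OF D_cont A(1)]])
    moreover have "openin T_unif V" using \<V> A(2) by (simp add: topology_base_def)
    ultimately show "openin T_fine A" unfolding A(3) by (rule openin_fine_scaling)
  next
    fix U f assume "openin T_fine U \<and> f \<in> U"
    then show "\<exists>A\<in>scalings D \<V>. f \<in> A \<and> A \<subseteq> U"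
      using \<V> by (intro scalings_refine[OF D(3) D_cont]) (simp_all add: topology_base_def)
  qed
  moreover have "|D| \<le>o |\<V>|"
    by (rule ordLeq_transitive[OF D(2) card_of_mono1]) blast
  ultimately show "\<exists>\<V>'. topology_base T_fine \<V>' \<and> |\<V>'| \<le>o natLeq +c |\<V>|"
    by (intro exI[of _ "scalings D \<V>"] conjI card_of_scalings)
qed

text \<open>
  Each basic fine neighbourhood \<open>V\<close> of zero contains a ball along some filter \<open>G V\<close>. When \<open>V\<close> lies in
  the uniform unit ball along \<open>F\<close>, closeness along \<open>G V\<close> implies closeness along \<open>F\<close> by
  \<open>uniform_bound_transfer\<close>, so the filters \<open>G V\<close> determine the uniform topology.
\<close>

lemma weight_unif_le: "weight T_unif \<le>o weight T_fine"
proof (rule weight_ordLeqI)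
  fix \<V> assume \<V>: "topology_base T_fine \<V>"
  obtain D where D: "D \<subseteq> topspace T_fine" "|D| \<le>o |\<V> - {{}}|"
    and dense: "T_fine closure_of D = topspace T_fine"
    by (rule dense_subset_of_network[OF network_topology_base[OF \<V>]]) blast
  have "\<forall>V\<in>{V \<in> \<V>. 0 \<in> V}. \<exists>G \<epsilon>. G \<in> \<F> \<and> \<epsilon> \<in> pos_cont_fun \<and>
      (\<forall>g\<in>cont_fun. (\<forall>\<^sub>F x in G. \<bar>g x\<bar> < \<epsilon> x) \<longrightarrow> g \<in> V)"
  proof
    fix V assume "V \<in> {V \<in> \<V>. 0 \<in> V}"
    then have V: "openin T_fine V" "0 \<in> V" using \<V> by (auto simp: topology_base_def)
    obtain G \<epsilon> where "G \<in> \<F>" "\<epsilon> \<in> pos_cont_fun"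
      "\<And>g. g \<in> cont_fun \<Longrightarrow> \<forall>\<^sub>F x in G. \<bar>0 x - g x\<bar> < \<epsilon> x \<Longrightarrow> g \<in> V"
      by (rule openin_fineE[OF V]) blast
    then show "\<exists>G \<epsilon>. G \<in> \<F> \<and> \<epsilon> \<in> pos_cont_fun \<and>
      (\<forall>g\<in>cont_fun. (\<forall>\<^sub>F x in G. \<bar>g x\<bar> < \<epsilon> x) \<longrightarrow> g \<in> V)"
      by (intro exI[of _ G] exI[of _ \<epsilon>]) (simp add: zero_fun_def)
  qed
  from bchoice[OF this] obtain G where
    "\<forall>V\<in>{V \<in> \<V>. 0 \<in> V}. \<exists>\<epsilon>. G V \<in> \<F> \<and> \<epsilon> \<in> pos_cont_fun \<and>
      (\<forall>g\<in>cont_fun. (\<forall>\<^sub>F x in G V. \<bar>g x\<bar> < \<epsilon> x) \<longrightarrow> g \<in> V)" ..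
  from bchoice[OF this] obtain \<epsilon> where
    "\<forall>V\<in>{V \<in> \<V>. 0 \<in> V}. G V \<in> \<F> \<and> \<epsilon> V \<in> pos_cont_fun \<and>
      (\<forall>g\<in>cont_fun. (\<forall>\<^sub>F x in G V. \<bar>g x\<bar> < \<epsilon> V x) \<longrightarrow> g \<in> V)" ..
  note choice = bspec[OF this, OF CollectI, OF conjI]
  have G: "G V \<in> \<F>" and \<epsilon>: "\<epsilon> V \<in> pos_cont_fun" if "V \<in> \<V>" "0 \<in> V" for V
    using choice[OF that] by (rule conjunct1, rule conjunct1[OF conjunct2])
  have sub: "g \<in> V" if "V \<in> \<V>" "0 \<in> V" "g \<in> cont_fun" "\<forall>\<^sub>F x in G V. \<bar>g x\<bar> < \<epsilon> V x" for V g
    using choice[OF that(1,2)] that(3,4) by (elim conjE) (drule bspec, assumption, erule mp)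
  define ball where "ball s V n =
    {g \<in> cont_fun. \<forall>\<^sub>F x in G V. \<bar>s x - g x\<bar> < 1 / real (Suc n)}" for s V n
  define \<V>' where "\<V>' = (\<lambda>(s, V, n). T_unif interior_of ball s V n) ` (D \<times> \<V> \<times> UNIV)"
  have "topology_base T_unif \<V>'"
    unfolding topology_base_def
  proof (intro conjI ballI allI impI; (elim conjE)?)
    fix A assume "A \<in> \<V>'"
    then show "openin T_unif A" by (auto simp: \<V>'_def)
  next
    fix U f assume U: "openin T_unif U" "f \<in> U"
    have f: "f \<in> cont_fun" using openin_subset[OF U(1)] U(2) by (auto simp: topspace_unif)
    obtain F c where F: "F \<in> \<F>" and c: "0 < c"
      and U_ball: "\<And>g. g \<in> cont_fun \<Longrightarrow> \<forall>\<^sub>F x in F. \<bar>f x - g x\<bar> < c \<Longrightarrow> g \<in> U"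
      by (rule openin_unifE[OF U]) blast
    obtain n where n: "1 / real (Suc n) < c / 4"
      using c nat_approx_posE[of "c / 4"] by auto
    \<comment> \<open>\<open>f\<close> and a member \<open>g\<close> of the ball around \<open>s\<close> will differ by less than \<open>2 * \<eta>\<close> along \<open>G V\<close>, and
      the transfer to \<open>F\<close> doubles this.\<close>
    define \<eta> where "\<eta> = 1 / real (Suc n)"
    have \<eta>: "0 < \<eta>" "4 * \<eta> < c" using n by (simp_all add: \<eta>_def)
    define A :: "('a \<Rightarrow> real) set" where "A = {g. \<forall>\<^sub>F x in F. \<bar>g x\<bar> < 1}"
    have "0 \<in> T_unif interior_of A"
      by (rule interior_of_unifI[OF F zero_less_one]) (auto simp: A_def cont_fun_def zero_fun_def)
    with \<V> openin_fine_if_openin_unif[OF openin_interior_of[of T_unif A]]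
    obtain V where V: "V \<in> \<V>" "0 \<in> V" "V \<subseteq> T_unif interior_of A"
      unfolding topology_base_def by blast
    from V(3) have VA: "V \<subseteq> A" using interior_of_subset by (rule subset_trans)
    \<comment> \<open>Half of \<open>\<eta>\<close> leaves room for a neighbourhood of \<open>f\<close> inside the ball around \<open>s\<close>: the interior
      of the ball, and not merely the ball, must contain \<open>f\<close>.\<close>
    have "f \<in> T_unif interior_of {s. \<forall>\<^sub>F x in G V. \<bar>f x - s x\<bar> < \<eta> / 2}"
      by (rule interior_of_unifI[OF G[OF V(1,2)] _ f, of "\<eta> / 2"]) (simp_all add: \<eta>)
    then obtain s where s: "s \<in> D" "\<forall>\<^sub>F x in G V. \<bar>f x - s x\<bar> < \<eta> / 2"
      using dense[unfolded dense_intersects_open]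
        openin_fine_if_openin_unif[OF openin_interior_of[of T_unif "{s. \<forall>\<^sub>F x in G V. \<bar>f x - s x\<bar> < \<eta> / 2}"]]
        interior_of_subset[of T_unif "{s. \<forall>\<^sub>F x in G V. \<bar>f x - s x\<bar> < \<eta> / 2}"] by blast
    have "f \<in> T_unif interior_of ball s V n"
    proof (rule interior_of_unifI[OF G[OF V(1,2)] _ f, of "\<eta> / 2"])
      fix g assume g: "g \<in> cont_fun" "\<forall>\<^sub>F x in G V. \<bar>f x - g x\<bar> < \<eta> / 2"
      from s(2) g(2) have "\<forall>\<^sub>F x in G V. \<bar>s x - g x\<bar> < \<eta>"
        by eventually_elim linarith
      with g(1) show "g \<in> ball s V n" by (simp add: ball_def \<eta>_def)
    qed (simp add: \<eta>)
    moreover have "ball s V n \<subseteq> U"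
    proof
      fix g assume "g \<in> ball s V n"
      then have g: "g \<in> cont_fun" "\<forall>\<^sub>F x in G V. \<bar>s x - g x\<bar> < \<eta>"
        by (auto simp: ball_def \<eta>_def)
      have "\<forall>\<^sub>F x in F. \<bar>f x - g x\<bar> < 2 * (2 * \<eta>)"
      proof (rule uniform_bound_transfer[OF _ \<epsilon>[OF V(1,2)]])
        show "\<forall>\<^sub>F x in F. \<bar>k x\<bar> < 1"
          if "k \<in> cont_fun" "\<forall>\<^sub>F x in G V. \<bar>k x\<bar> < \<epsilon> V x" for k
          using sub[OF V(1,2) that] VA by (auto simp: A_def)
        show "(\<lambda>x. f x - g x) \<in> cont_fun"
          using f g(1) by (auto simp: cont_fun_def intro!: continuous_intros)
        show "\<forall>\<^sub>F x in G V. \<bar>f x - g x\<bar> < 2 * \<eta>"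
          using s(2) g(2) by eventually_elim (use \<eta>(1) in linarith)
      qed (simp add: \<eta>)
      then have "\<forall>\<^sub>F x in F. \<bar>f x - g x\<bar> < c"
        by (rule eventually_mono) (use \<eta>(2) in linarith)
      with g(1) show "g \<in> U" by (rule U_ball)
    qed
    moreover have member: "T_unif interior_of ball s V n \<in> \<V>'"
      unfolding \<V>'_def using s(1) V(1) by (intro image_eqI[of _ _ "(s, V, n)"]) simp_all
    ultimately show "\<exists>A\<in>\<V>'. f \<in> A \<and> A \<subseteq> U"
      using subset_trans[OF interior_of_subset[of T_unif "ball s V n"]] member
      by (intro bexI[of _ "T_unif interior_of ball s V n"] conjI)
  qed
  moreover have "|\<V>'| \<le>o natLeq +c |\<V>|"
    unfolding \<V>'_def
  proof (intro ordLeq_transitive[OF card_of_image] card_of_Times_ordLeq_natLeq_csum)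
    have "|D| \<le>o |\<V>|"
      by (rule ordLeq_transitive[OF D(2) card_of_mono1]) blast
    then show "|D| \<le>o natLeq +c |\<V>|" using ordLeq_natLeq_csum by (rule ordLeq_transitive)
    show "|\<V>| \<le>o natLeq +c |\<V>|" by (rule ordLeq_natLeq_csum)
    show "|UNIV :: nat set| \<le>o natLeq +c |\<V>|"
      by (rule ordIso_ordLeq_trans[OF card_of_nat]) (simp add: ordLeq_csum1 natLeq_Card_order)
  qed
  ultimately show "\<exists>\<V>'. topology_base T_unif \<V>' \<and> |\<V>'| \<le>o natLeq +c |\<V>|" by blast
qed

lemma cardinal_invariants_fine_eq:
  "weight T_fine =o weight T_unif \<and> network_weight T_fine =o network_weight T_unif \<and>
   narrowness_index T_fine =o narrowness_index T_unif"
proof (intro conjI)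
  show "weight T_fine =o weight T_unif"
    using weight_fine_le weight_unif_le by (simp add: ordIso_iff_ordLeq)
  show "network_weight T_fine =o network_weight T_unif" by (rule network_weight_fine_eq)
  show "narrowness_index T_fine =o narrowness_index T_unif"
    unfolding narrowness_index_def narrow_fine_iff by (rule ordIso_refl[OF Card_order_csum])
qed

end

section \<open>The filters of a bornology\<close>

definition enlargement_filter :: "'a::metric_space set \<Rightarrow> 'a filter" where
  "enlargement_filter B = (INF \<delta>\<in>{0<..}. principal (enlargement B \<delta>))"

lemma eventually_enlargement_filter:
  "eventually P (enlargement_filter B) \<longleftrightarrow> (\<exists>\<delta>>0. \<forall>x\<in>enlargement B \<delta>. P x)"
  unfolding enlargement_filter_def
proof (subst eventually_INF_base)
  show "{0::real<..} \<noteq> {}" by simp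
  show "\<exists>x\<in>{0<..}. principal (enlargement B x)
      \<le> inf (principal (enlargement B a)) (principal (enlargement B b))"
    if "a \<in> {0<..}" "b \<in> {0<..}" for a b :: real
  proof (rule bexI[of _ "min a b"])
    show "principal (enlargement B (min a b))
      \<le> inf (principal (enlargement B a)) (principal (enlargement B b))"
      by (simp add: enlargement_mono)
    show "min a b \<in> {0<..}" using that by simp
  qed
qed (simp add: eventually_principal Bex_def)

lemma filter_ent_principal: "filter_ent (principal B) \<epsilon> = ent_w B \<epsilon>"
  by (simp add: filter_ent_def ent_w_def eventually_principal)

lemma filter_ent_enlargement_filter: "filter_ent (enlargement_filter B) \<epsilon> = ent_sw B \<epsilon>"
  by (simp add: filter_ent_def ent_sw_def eventually_enlargement_filter)

lemma uniform_ents_image: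
  "uniform_ents (\<phi> ` \<B>) = {filter_ent (\<phi> B) (\<lambda>_. c) | B c. B \<in> \<B> \<and> 0 < c}"
  unfolding uniform_ents_def by blast

lemma fine_ents_image:
  "fine_ents (\<phi> ` \<B>) = {filter_ent (\<phi> B) \<epsilon> | B \<epsilon>. B \<in> \<B> \<and> \<epsilon> \<in> pos_cont_fun}"
  unfolding fine_ents_def by blast

lemma uniform_ents_principal:
  "uniform_ents (principal ` \<B>) = {ent B \<epsilon> | B \<epsilon>. B \<in> \<B> \<and> 0 < \<epsilon>}"
  by (simp add: uniform_ents_image filter_ent_principal ent_w_def ent_def)

lemma fine_ents_principal:
  "fine_ents (principal ` \<B>) = {ent_w B \<epsilon> | B \<epsilon>. B \<in> \<B> \<and> \<epsilon> \<in> pos_cont_fun}"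
  by (simp add: fine_ents_image filter_ent_principal)

lemma uniform_ents_enlargement_filter:
  "uniform_ents (enlargement_filter ` \<B>) = {ent_s B \<epsilon> | B \<epsilon>. B \<in> \<B> \<and> 0 < \<epsilon>}"
  by (simp add: uniform_ents_image filter_ent_enlargement_filter ent_sw_def ent_s_def)

lemma fine_ents_enlargement_filter:
  "fine_ents (enlargement_filter ` \<B>) = {ent_sw B \<epsilon> | B \<epsilon>. B \<in> \<B> \<and> \<epsilon> \<in> pos_cont_fun}"
  by (simp add: fine_ents_image filter_ent_enlargement_filter)

theorem theorem5p6:
  fixes \<B> :: "'a::metric_space set set"
  assumes "\<exists>x y :: 'a. x \<noteq> y"
    and "bornology \<B>"
    and "has_closed_base \<B>"
  shows "(weight (tau_sw \<B>) =o weight (tau_s \<B>) \<and> weight (tau_w \<B>) =o weight (tau \<B>)) \<and>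
         (network_weight (tau_sw \<B>) =o network_weight (tau_s \<B>) \<and>
          network_weight (tau_w \<B>) =o network_weight (tau \<B>)) \<and>
         (narrowness_index (tau_sw \<B>) =o narrowness_index (tau_s \<B>) \<and>
          narrowness_index (tau_w \<B>) =o narrowness_index (tau \<B>))"
proof -
  interpret on_sets: filter_uniformities "principal ` \<B>"
    using uniformity_base_tau[OF assms(2)] uniformity_base_tau_w[OF assms(2)]
    by unfold_locales (simp_all only: uniform_ents_principal fine_ents_principal)
  interpret near_sets: filter_uniformities "enlargement_filter ` \<B>"
    using uniformity_base_tau_s[OF assms(2)] uniformity_base_tau_sw[OF assms(2)]
    by unfold_locales
      (simp_all only: uniform_ents_enlargement_filter fine_ents_enlargement_filter)
  show ?thesis
    using on_sets.cardinal_invariants_fine_eq near_sets.cardinal_invariants_fine_eq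
    unfolding tau_def tau_s_def tau_w_def tau_sw_def uniform_ents_principal fine_ents_principal
      uniform_ents_enlargement_filter fine_ents_enlargement_filter
    by blast
qed

end
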